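(* Let $f:\mathbb{R}^n\to\mathbb{R}$ be locally Lipschitz. Let $\{\mathbf{x}_k\}_{k\ge0}\subset\mathbb{R}^n$, and let $\{\lambda_k\}_{k\ge0}$, $\{\varepsilon_k\}_{k\ge0}$ be sequences of positive numbers with $\lambda_k\to0$ and $\varepsilon_k\to0$. For each $k$, let $\mathcal V(\mathbf{x}_k)=\{\mathbf{g}_1,\dots,\mathbf{g}_{m_k}\}$ be a finite set of discrete gradients $\mathbf{g}_\ell=\mathbf{g}(\mathbf{y}_\ell,\mathbf{d}_\ell,\mathbf{e}_\ell,z_k,\lambda_k,\omega)$ constructed at sampling points $\mathbf{y}_1,\dots,\mathbf{y}_{m_k}$ (depending on $k$) satisfying $$\|\mathbf{y}_\ell-\mathbf{x}_k\|\le\varepsilon_k,\qquad \ell=1,\dots,m_k,$$ using the discretization parameter $\lambda_k$. Assume that at each sampling point $\mathbf{y}_\ell$ the pointwise discrete-gradient approximation property holds (i.e. for all sufficiently small $\lambda>0$, $V(\mathbf{y}_\ell,\lambda)\subset\partial f(\mathbf{y}_\ell)+B(0,\delta(\lambda))$ with $\delta(\lambda)\to0$ as $\lambda\to0$), and suppose that the corresponding pointwise errors are bounded by $\delta_k\to0$, i.e. $$V(\mathbf{y}_\ell,\lambda_k)\subset\partial f(\mathbf{y}_\ell)+B(0,\delta_k),\qquad \ell=1,\dots,m_k.$$ Then $$\operatorname{conv}(\mathcal V(\mathbf{x}_k))\subset\partial_{\varepsilon_k}f(\mathbf{x}_k)+B(0,\delta_k).$$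
   Context: $\|\cdot\|$ is the Euclidean norm and $B(0,r)=\{\mathbf{y}\in\mathbb{R}^n:\|\mathbf{y}\|\le r\}$. $\partial f$ is the Clarke subdifferential of the locally Lipschitz function $f$, and $\partial_\varepsilon f(\mathbf{x})=\operatorname{cl}\operatorname{conv}\big(\bigcup_{\|\mathbf{y}-\mathbf{x}\|\le\varepsilon}\partial f(\mathbf{y})\big)$ is the Goldstein $\varepsilon$-subdifferential. Discrete gradients. Let $D=\{\mathbf{d}\in\mathbb{R}^n:\|\mathbf{d}\|=1\}$, $G=\{\mathbf{e}\in\mathbb{R}^n:|e_j|=1,\ j=1,\dots,n\}$, and let $P$ be the set of functions $z:(0,\infty)\to(0,\infty)$ with $z(\lambda)/\lambda\to0$ as $\lambda\to0^+$. For $\mathbf{x}\in\mathbb{R}^n$, $\mathbf{d}\in D$, $\mathbf{e}\in G$, $z\in P$, $\lambda>0$, $\omega\in(0,1]$, let $i_{\max}$ be an index $j$ maximizing $|d_j|$, and put $\mathbf{x}^{(0)}=\mathbf{x}+\lambda\mathbf{d}$ and $\mathbf{x}^{(j)}=\mathbf{x}^{(0)}+z(\lambda)(\omega e_1,\omega^2e_2,\dots,\omega^je_j,0,\dots,0)^\top$ for $j=1,\dots,n$. The discrete gradient $\mathbf{g}(\mathbf{x},\mathbf{d},\mathbf{e},z,\lambda,\omega)\in\mathbb{R}^n$ has components $g_j=\dfrac{f(\mathbf{x}^{(j)})-f(\mathbf{x}^{(j-1)})}{z(\lambda)\omega^je_j}$ for $j\ne i_{\max}$, and $g_{i_{\max}}=\dfrac{f(\mathbf{x}+\lambda\mathbf{d})-f(\mathbf{x})-\lambda\sum_{j\ne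 i_{\max}}g_jd_j}{\lambda d_{i_{\max}}}$. The discrete-gradient set is $V(\mathbf{x},\lambda)=\operatorname{cl}\operatorname{conv}\{\mathbf{g}(\mathbf{x},\mathbf{d},\mathbf{e},z,\lambda,\omega):\mathbf{d}\in D,\ \mathbf{e}\in G,\ z\in P,\ \omega\in(0,1]\}$. In the construction of $\mathcal V(\mathbf{x}_k)$, $\mathbf{d}_\ell\in D$, $\mathbf{e}_\ell\in G$, $z_k\in P$, $\omega\in(0,1]$. *)

theory Defs
  imports "HOL-Analysis.Analysis" "HOL-Library.Set_Algebras"
begin

definition locally_lipschitz :: "('a::metric_space \<Rightarrow> real) \<Rightarrow> bool" where
  "locally_lipschitz f \<longleftrightarrow> (\<forall>x. \<exists>r>0. \<exists>L. L-lipschitz_on (ball x r) f)"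

(* The limsup over y -> x (y = x allowed) and t -> 0 from the right, taken in the extended
   reals; it is finite when f is locally Lipschitz. *)
definition clarke_derivative :: "('a::euclidean_space \<Rightarrow> real) \<Rightarrow> 'a \<Rightarrow> 'a \<Rightarrow> ereal" where
  "clarke_derivative f x v =
     Limsup (nhds x \<times>\<^sub>F at_right 0) (\<lambda>(y, t). ereal ((f (y + t *\<^sub>R v) - f y) / t))"

definition clarke_subdifferential :: "('a::euclidean_space \<Rightarrow> real) \<Rightarrow> 'a \<Rightarrow> 'a set" where
  "clarke_subdifferential f x = {\<xi>. \<forall>v. ereal (\<xi> \<bullet> v) \<le> clarke_derivative f x v}"

definition goldstein_subdifferential ::
    "real \<Rightarrow> ('a::euclidean_space \<Rightarrow> real) \<Rightarrow> 'a \<Rightarrow> 'a set" where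
  "goldstein_subdifferential \<epsilon> f x =
     closure (convex hull (\<Union>y\<in>{y. norm (y - x) \<le> \<epsilon>}. clarke_subdifferential f y))"

definition unit_directions :: "(real ^ 'n) set" where
  "unit_directions = {d. norm d = 1}"

definition sign_vectors :: "(real ^ 'n) set" where
  "sign_vectors = {e. \<forall>j. \<bar>e $ j\<bar> = 1}"

(* The values of z outside (0, \<infinity>) are never used. *)
definition step_functions :: "(real \<Rightarrow> real) set" where
  "step_functions = {z. (\<forall>t>0. z t > 0) \<and> ((\<lambda>t. z t / t) \<longlongrightarrow> 0) (at_right 0)}"

(* The coordinates of real ^ 'n are numbered 1, ..., CARD('n) along the linear order of 'n. *)
definition coord_number :: "'n::{finite,linorder} \<Rightarrow> nat" where
  "coord_number j = card {i. i \<le> j}"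

(* The maximal |d_j| may be attained at several indices; imax is any rule choosing one. *)
definition max_index_rule :: "(real ^ 'n::finite \<Rightarrow> 'n) \<Rightarrow> bool" where
  "max_index_rule imax \<longleftrightarrow> (\<forall>d\<in>unit_directions. \<forall>j. \<bar>d $ j\<bar> \<le> \<bar>d $ imax d\<bar>)"

definition shifted_point ::
    "real ^ 'n::{finite,linorder} \<Rightarrow> real ^ 'n::_ \<Rightarrow> real ^ 'n::_
     \<Rightarrow> (real \<Rightarrow> real) \<Rightarrow> real \<Rightarrow> real \<Rightarrow> nat \<Rightarrow> real ^ 'n::_" where
  "shifted_point x d e z t \<omega> m =
     x + t *\<^sub>R d +
     z t *\<^sub>R (\<chi> i. if coord_number i \<le> m then \<omega> ^ coord_number i * e $ i else 0)"

definition difference_quotient ::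
    "(real ^ 'n::{finite,linorder} \<Rightarrow> real)
     \<Rightarrow> real ^ 'n::_ \<Rightarrow> real ^ 'n::_ \<Rightarrow> real ^ 'n::_
     \<Rightarrow> (real \<Rightarrow> real) \<Rightarrow> real \<Rightarrow> real \<Rightarrow> 'n \<Rightarrow> real" where
  "difference_quotient f x d e z t \<omega> j =
     (f (shifted_point x d e z t \<omega> (coord_number j))
        - f (shifted_point x d e z t \<omega> (coord_number j - 1)))
     / (z t * \<omega> ^ coord_number j * e $ j)"

definition discrete_gradient ::
    "(real ^ 'n::{finite,linorder} \<Rightarrow> 'n) \<Rightarrow> (real ^ 'n::_ \<Rightarrow> real)
     \<Rightarrow> real ^ 'n::_ \<Rightarrow> real ^ 'n::_ \<Rightarrow> real ^ 'n::_
     \<Rightarrow> (real \<Rightarrow> real) \<Rightarrow> real \<Rightarrow> real \<Rightarrow> real ^ 'n::_" where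
  "discrete_gradient imax f x d e z t \<omega> =
     (\<chi> j. if j \<noteq> imax d then difference_quotient f x d e z t \<omega> j
           else (f (x + t *\<^sub>R d) - f x
                   - t * (\<Sum>i\<in>UNIV - {imax d}. difference_quotient f x d e z t \<omega> i * d $ i))
                / (t * d $ imax d))"

definition discrete_gradient_set ::
    "(real ^ 'n::{finite,linorder} \<Rightarrow> 'n) \<Rightarrow> (real ^ 'n::_ \<Rightarrow> real) \<Rightarrow> real ^ 'n::_ \<Rightarrow> real
     \<Rightarrow> (real ^ 'n::_) set" where
  "discrete_gradient_set imax f x t =
     closure (convex hull {discrete_gradient imax f x d e z t \<omega> | d e z \<omega>.
       d \<in> unit_directions \<and> e \<in> sign_vectors \<and> z \<in> step_functions \<and> \<omega> \<in> {0<..1}})"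

definition pointwise_approximation_property ::
    "(real ^ 'n::{finite,linorder} \<Rightarrow> 'n) \<Rightarrow> (real ^ 'n::_ \<Rightarrow> real) \<Rightarrow> real ^ 'n::_ \<Rightarrow> bool" where
  "pointwise_approximation_property imax f y \<longleftrightarrow>
     (\<exists>\<delta>. (\<delta> \<longlongrightarrow> 0) (at_right 0) \<and>
          (\<forall>\<^sub>F t in at_right 0.
             discrete_gradient_set imax f y t \<subseteq> clarke_subdifferential f y + cball 0 (\<delta> t)))"

end

theory Submission
  imports Defs
begin

text \<open>
  The target set is convex, being the Minkowski sum of the Goldstein subdifferential (the closure
  of a convex hull) and a ball, so only the individual discrete gradients have to be located in it.
  Each of them lies in the discrete-gradient set of its own sampling point \<open>y\<close>, hence
  within \<open>\<delta>\<close> of the Clarke subdifferential at \<open>y\<close>; and that subdifferential is one of those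
  collected by the Goldstein subdifferential, since \<open>y\<close> is within \<open>\<epsilon>\<close> of the centre.
\<close>

lemma clarke_subset_goldstein:
  assumes "norm (y - x) \<le> \<epsilon>"
  shows "clarke_subdifferential f y \<subseteq> goldstein_subdifferential \<epsilon> f x"
proof -
  have "clarke_subdifferential f y
      \<subseteq> (\<Union>u\<in>{u. norm (u - x) \<le> \<epsilon>}. clarke_subdifferential f u)"
    using assms by blast
  then show ?thesis
    unfolding goldstein_subdifferential_def
    by (meson closure_subset hull_subset subset_trans)
qed

lemma convex_goldstein_subdifferential: "convex (goldstein_subdifferential \<epsilon> f x)"
  unfolding goldstein_subdifferential_def by (intro convex_closure convex_convex_hull)

lemma discrete_gradient_in_discrete_gradient_set:
  assumes "d \<in> unit_directions" "e \<in> sign_vectors" "z \<in> step_functions" "\<omega> \<in> {0<..1}"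
  shows "discrete_gradient imax f x d e z t \<omega> \<in> discrete_gradient_set imax f x t"
  unfolding discrete_gradient_set_def
  by (rule subsetD[OF closure_subset], rule hull_inc) (use assms in blast)

theorem proposition2:
  fixes f :: "real ^ 'n::{finite,linorder} \<Rightarrow> real"
    and imax :: "real ^ 'n::_ \<Rightarrow> 'n"
    and x :: "nat \<Rightarrow> real ^ 'n::_"
    and lam \<epsilon> \<delta> :: "nat \<Rightarrow> real"
    and m :: "nat \<Rightarrow> nat"
    and y d e :: "nat \<Rightarrow> nat \<Rightarrow> real ^ 'n::_"
    and z :: "nat \<Rightarrow> real \<Rightarrow> real"
    and \<omega> :: real
    and \<V> :: "nat \<Rightarrow> (real ^ 'n::_) set"
  assumes "locally_lipschitz f"
    and "max_index_rule imax"
    and "\<And>k. lam k > 0" and "lam \<longlonglongrightarrow> 0"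
    and "\<And>k. \<epsilon> k > 0" and "\<epsilon> \<longlonglongrightarrow> 0"
    and "\<And>k l. l \<in> {1..m k} \<Longrightarrow> d k l \<in> unit_directions"
    and "\<And>k l. l \<in> {1..m k} \<Longrightarrow> e k l \<in> sign_vectors"
    and "\<And>k. z k \<in> step_functions"
    and "\<omega> \<in> {0<..1}"
    and "\<And>k. \<V> k =
      {discrete_gradient imax f (y k l) (d k l) (e k l) (z k) (lam k) \<omega> | l. l \<in> {1..m k}}"
    and "\<And>k l. l \<in> {1..m k} \<Longrightarrow> norm (y k l - x k) \<le> \<epsilon> k"
    and "\<And>k l. l \<in> {1..m k} \<Longrightarrow> pointwise_approximation_property imax f (y k l)"
    and "\<delta> \<longlonglongrightarrow> 0"
    and "\<And>k l. l \<in> {1..m k} \<Longrightarrow>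
      discrete_gradient_set imax f (y k l) (lam k)
        \<subseteq> clarke_subdifferential f (y k l) + cball 0 (\<delta> k)"
  shows "\<forall>k. convex hull (\<V> k) \<subseteq> goldstein_subdifferential (\<epsilon> k) f (x k) + cball 0 (\<delta> k)"
proof
  fix k
  let ?A = "goldstein_subdifferential (\<epsilon> k) f (x k) + cball 0 (\<delta> k)"
  have "\<V> k \<subseteq> ?A"
  proof
    fix g assume "g \<in> \<V> k"
    then obtain l where l: "l \<in> {1..m k}"
      and g: "g = discrete_gradient imax f (y k l) (d k l) (e k l) (z k) (lam k) \<omega>"
      using assms(11) by blast
    have "g \<in> discrete_gradient_set imax f (y k l) (lam k)"
      unfolding g using assms(7,8)[OF l] assms(9,10)
      by (rule discrete_gradient_in_discrete_gradient_set)
    also have "\<dots> \<subseteq> clarke_subdifferential f (y k l) + cball 0 (\<delta> k)"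
      by (rule assms(15)[OF l])
    also have "\<dots> \<subseteq> ?A"
      by (intro set_plus_mono2 clarke_subset_goldstein assms(12)[OF l] order_refl)
    finally show "g \<in> ?A" .
  qed
  moreover have "convex ?A"
    by (intro convex_set_plus convex_goldstein_subdifferential convex_cball)
  ultimately show "convex hull (\<V> k) \<subseteq> ?A"
    by (rule hull_minimal)
qed

end
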